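(* Let $a, b, c$ be nonzero integers with $\gcd(a,b,c)=1$ and let $m, n$ be positive integers. If $X, Y \in M_2(\mathbb{Z})$ satisfy $aX^m + bY^n = cI$ and $XY \neq YX$, then $X^m$ and $Y^n$ are scalar matrices.
   Context: $M_2(\mathbb{Z})$ denotes the ring of $2\times 2$ matrices with integer entries, and $I$ is the $2\times 2$ identity matrix. A scalar matrix is a matrix of the form $\lambda I$. *)

theory Defs
  imports "Jordan_Normal_Form.Matrix"
begin

definition scalar_matrix :: "nat \<Rightarrow> 'a::semiring_1 mat \<Rightarrow> bool" where
  "scalar_matrix d A \<longleftrightarrow> (\<exists>l. A = l \<cdot>\<^sub>m 1\<^sub>m d)"

end

(* By Cayley-Hamilton, B^k = p B + q I for every 2x2 matrix B. Since a X^m = c I - b Y^n commutes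
   with Y and a is nonzero, X^m commutes with Y. With X^m = p X + q I, this gives
   p (XY - YX) = 0, so p = 0. The argument for Y^n is symmetric. *)
theory Submission
  imports Defs
begin

text \<open>Induction on \<open>k\<close>: multiplying \<open>p B + q I\<close> by \<open>B\<close>
  creates a \<open>B^2\<close> term, which Cayley-Hamilton turns back into a combination of
  \<open>B\<close> and \<open>I\<close>.\<close>

lemma pow_mat_two_linear:
  fixes B :: "'a::comm_ring_1 mat"
  assumes B: "B \<in> carrier_mat 2 2"
  shows "\<exists>p q. B ^\<^sub>m k = p \<cdot>\<^sub>m B + q \<cdot>\<^sub>m 1\<^sub>m 2"
proof (induction k)
  case 0
  have "B ^\<^sub>m 0 = 0 \<cdot>\<^sub>m B + 1 \<cdot>\<^sub>m 1\<^sub>m 2"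
    using B by (intro eq_matI) auto
  then show ?case by blast
next
  case (Suc k)
  then obtain p q where pq: "B ^\<^sub>m k = p \<cdot>\<^sub>m B + q \<cdot>\<^sub>m 1\<^sub>m 2" by blast
  \<comment> \<open>Trace and determinant of \<open>B\<close>. Substituting
    \<open>B^2 = t B - d I\<close> into \<open>p B^2 + q B\<close> gives the new coefficients
    \<open>p t + q\<close> and \<open>- p d\<close>; the identity is checked entry by entry.\<close>
  let ?t = "B $$ (0,0) + B $$ (1,1)"
  let ?d = "B $$ (0,0) * B $$ (1,1) - B $$ (0,1) * B $$ (1,0)"
  have "B ^\<^sub>m Suc k = (p * ?t + q) \<cdot>\<^sub>m B + (- p * ?d) \<cdot>\<^sub>m 1\<^sub>m 2"
    unfolding pow_mat.simps pq
    using B by (intro eq_matI)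
      (auto simp: scalar_prod_def numeral_2_eq_2 less_Suc_eq algebra_simps)
  then show ?case by blast
qed

lemma pow_mat_commute:
  assumes "A \<in> carrier_mat d d"
  shows "A * A ^\<^sub>m k = A ^\<^sub>m k * A"
proof (induction k)
  case 0
  then show ?case using assms by simp
next
  case (Suc k)
  have "A * A ^\<^sub>m Suc k = A * A ^\<^sub>m k * A"
    using assms by (simp add: assoc_mult_mat[of _ d d _ d _ d])
  then show ?case using Suc.IH by simp
qed

lemma smult_mat_cancel:
  fixes A B :: "'a::idom mat"
  assumes eq: "a \<cdot>\<^sub>m A = a \<cdot>\<^sub>m B" and "a \<noteq> 0"
    and A: "A \<in> carrier_mat r s" and B: "B \<in> carrier_mat r s"
  shows "A = B"
proof (rule eq_matI)
  fix i j assume "i < dim_row B" "j < dim_col B"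
  with arg_cong[OF eq, of "\<lambda>Z. Z $$ (i,j)"] A B \<open>a \<noteq> 0\<close>
  show "A $$ (i,j) = B $$ (i,j)" by simp
qed (use A B in auto)

text \<open>\<open>A\<close> commutes with \<open>c I\<close> and with \<open>b N\<close>, hence
  with their difference \<open>a M\<close>; in an integral domain the nonzero factor
  \<open>a\<close> can then be cancelled.\<close>

lemma commute_of_scalar_combination:
  fixes A M N :: "'a::idom mat"
  assumes A: "A \<in> carrier_mat d d" and M: "M \<in> carrier_mat d d" and N: "N \<in> carrier_mat d d"
    and sum: "a \<cdot>\<^sub>m M + b \<cdot>\<^sub>m N = c \<cdot>\<^sub>m 1\<^sub>m d" and "a \<noteq> 0"
    and comm: "A * N = N * A"
  shows "A * M = M * A"
proof -
  have "a \<cdot>\<^sub>m (A * M) + b \<cdot>\<^sub>m (A * N) = A * (a \<cdot>\<^sub>m M + b \<cdot>\<^sub>m N)"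
    using A M N by (simp add: mult_add_distrib_mat[of _ d d _ d] mult_smult_distrib[of _ d d _ d])
  also have "\<dots> = (a \<cdot>\<^sub>m M + b \<cdot>\<^sub>m N) * A"
    unfolding sum using A by (simp add: mult_smult_distrib[of _ d d _ d] mult_smult_assoc_mat[of _ d d _ d])
  also have "\<dots> = a \<cdot>\<^sub>m (M * A) + b \<cdot>\<^sub>m (A * N)"
    using A M N by (simp add: comm add_mult_distrib_mat[of _ d d _ _ d] mult_smult_assoc_mat[of _ d d _ d])
  finally have eq: "a \<cdot>\<^sub>m (A * M) + b \<cdot>\<^sub>m (A * N) = a \<cdot>\<^sub>m (M * A) + b \<cdot>\<^sub>m (A * N)" .
  \<comment> \<open>The common summand \<open>b (A N)\<close> is cancelled entrywise. Entries of
    products are kept folded, since expanding them into scalar products would hide the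
    cancellation.\<close>
  have "a \<cdot>\<^sub>m (A * M) = a \<cdot>\<^sub>m (M * A)"
  proof (rule eq_matI)
    fix i j assume "i < dim_row (a \<cdot>\<^sub>m (M * A))" "j < dim_col (a \<cdot>\<^sub>m (M * A))"
    with arg_cong[OF eq, of "\<lambda>Z. Z $$ (i,j)"] A M N
    show "(a \<cdot>\<^sub>m (A * M)) $$ (i,j) = (a \<cdot>\<^sub>m (M * A)) $$ (i,j)"
      by (simp del: index_mult_mat(1))
  qed (use A M in auto)
  then show ?thesis
    using \<open>a \<noteq> 0\<close> A M by (auto intro: smult_mat_cancel[of a _ _ d d])
qed

text \<open>Write \<open>B^k = p B + q I\<close>. If \<open>p\<close> were nonzero,
  \<open>p B = B^k - q I\<close> would commute with \<open>A\<close>, and so would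
  \<open>B\<close>.\<close>

lemma scalar_pow_mat_if_commute:
  fixes A B :: "'a::idom mat"
  assumes A: "A \<in> carrier_mat 2 2" and B: "B \<in> carrier_mat 2 2"
    and comm: "A * B ^\<^sub>m k = B ^\<^sub>m k * A" and ncomm: "A * B \<noteq> B * A"
  shows "scalar_matrix 2 (B ^\<^sub>m k)"
proof -
  obtain p q where pq: "B ^\<^sub>m k = p \<cdot>\<^sub>m B + q \<cdot>\<^sub>m 1\<^sub>m 2"
    using pow_mat_two_linear[OF B] by blast
  have "p = 0"
  proof (rule ccontr)
    assume "p \<noteq> 0"
    \<comment> \<open>The linear expression of \<open>B^k\<close>, rearranged to fit
      \<open>commute_of_scalar_combination\<close> with \<open>B\<close> as \<open>M\<close> and
      \<open>B^k\<close> as \<open>N\<close>.\<close>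
    moreover have "p \<cdot>\<^sub>m B + (- 1) \<cdot>\<^sub>m B ^\<^sub>m k = (- q) \<cdot>\<^sub>m 1\<^sub>m 2"
      unfolding pq using B by (intro eq_matI) auto
    ultimately show False
      using commute_of_scalar_combination[OF A B pow_carrier_mat[OF B]] comm ncomm by blast
  qed
  then have "B ^\<^sub>m k = q \<cdot>\<^sub>m 1\<^sub>m 2"
    unfolding pq using B by (intro eq_matI) auto
  then show ?thesis unfolding scalar_matrix_def by blast
qed

theorem theorem2p1:
  fixes a b c :: int and m n :: nat and X Y :: "int mat"
  assumes "a \<noteq> 0" and "b \<noteq> 0" and "c \<noteq> 0"
    and "Gcd {a, b, c} = 1"
    and "m > 0" and "n > 0"
    and "X \<in> carrier_mat 2 2" and "Y \<in> carrier_mat 2 2"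
    and "a \<cdot>\<^sub>m (X ^\<^sub>m m) + b \<cdot>\<^sub>m (Y ^\<^sub>m n) = c \<cdot>\<^sub>m 1\<^sub>m 2"
    and "X * Y \<noteq> Y * X"
  shows "scalar_matrix 2 (X ^\<^sub>m m) \<and> scalar_matrix 2 (Y ^\<^sub>m n)"
proof
  note X = \<open>X \<in> carrier_mat 2 2\<close> and Y = \<open>Y \<in> carrier_mat 2 2\<close>
  note Xm = pow_carrier_mat[OF X, of m] and Yn = pow_carrier_mat[OF Y, of n]
  \<comment> \<open>Here \<open>Y\<close> is tested against the relation: it commutes with its own
    power \<open>Y^n\<close>, and \<open>a\<close> is nonzero, so it commutes with
    \<open>X^m\<close>.\<close>
  have "Y * X ^\<^sub>m m = X ^\<^sub>m m * Y"
    using commute_of_scalar_combination[OF Y Xm Yn assms(9,1) pow_mat_commute[OF Y]] .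
  then show "scalar_matrix 2 (X ^\<^sub>m m)"
    using scalar_pow_mat_if_commute[OF Y X] assms(10) by metis
  \<comment> \<open>Swapping the summands puts \<open>Y^n\<close> in the place of \<open>M\<close>,
    so that \<open>b\<close> is now the coefficient to cancel.\<close>
  have "b \<cdot>\<^sub>m (Y ^\<^sub>m n) + a \<cdot>\<^sub>m (X ^\<^sub>m m) = c \<cdot>\<^sub>m 1\<^sub>m 2"
    using assms(9) Xm Yn by (metis comm_add_mat smult_carrier_mat)
  then have "X * Y ^\<^sub>m n = Y ^\<^sub>m n * X"
    using commute_of_scalar_combination[OF X Yn Xm _ assms(2) pow_mat_commute[OF X]] by blast
  then show "scalar_matrix 2 (Y ^\<^sub>m n)"
    using scalar_pow_mat_if_commute[OF X Y] assms(10) by metis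
qed

end
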